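(* Let $F$ be a symmetric Ferrers shape, $n\ge0$ an integer and $s,t$ positive integers. Let $N_{\mathrm{sym}}(F;n;\mathit{NE}=s,\mathit{SE}=t)$ be the number of symmetric $0$-$1$-fillings of $F$ with exactly $n$ ones, at most one $1$ in each row and each column, whose longest NE-chain has length $s$ and whose longest SE-chain (among those whose smallest enclosing rectangle is contained in $F$) has length $t$. Then $$N_{\mathrm{sym}}(F;n;\mathit{NE}=s,\mathit{SE}=t)=N_{\mathrm{sym}}(F;n;\mathit{NE}=t,\mathit{SE}=s).$$
   Context: A Ferrers shape (French notation) has columns $1,\dots,m$ from left to right and rows numbered from the bottom; column $j$ consists of the cells in rows $1,\dots,h_j$, $h_1\ge\dots\ge h_m\ge1$. Denote the cell in column $j$, row $i$ by $(j,i)$. $F$ is symmetric (self-conjugate) if $(j,i)\in F\iff(i,j)\in F$; a filling is symmetric if the entries of $(j,i)$ and $(i,j)$ agree for all cells. An NE-chain is a sequence of cells containing $1$, each strictly above and strictly to the right of the preceding one; an SE-chain is a sequence of cells containing $1$, each strictly below and strictly to the right of the preceding one; length = number of cells. The smallest enclosing rectangle of a chain consists of the cells whose column lies between the columns of the first and last cells and whose row lies between their rows. *)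

theory Defs
  imports "HOL-Library.FuncSet"
begin

text \<open>A cell is a pair (column, row), both counted from 1.\<close>

type_synonym cell = "nat \<times> nat"

definition ferrers_shape :: "cell set \<Rightarrow> bool" where
  "ferrers_shape F \<longleftrightarrow> (\<exists>(m::nat) (h::nat \<Rightarrow> nat).
     (\<forall>j\<in>{1..m}. 1 \<le> h j) \<and>
     (\<forall>j\<in>{1..m}. \<forall>k\<in>{1..m}. j \<le> k \<longrightarrow> h k \<le> h j) \<and>
     F = {(j, i). j \<in> {1..m} \<and> i \<in> {1..h j}})"

definition symmetric_shape :: "cell set \<Rightarrow> bool" where
  "symmetric_shape F \<longleftrightarrow> (\<forall>j i. (j, i) \<in> F \<longleftrightarrow> (i, j) \<in> F)"

definition fillings :: "cell set \<Rightarrow> (cell \<Rightarrow> nat) set" where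
  "fillings F = (F \<rightarrow>\<^sub>E {0, 1})"

definition ones :: "cell set \<Rightarrow> (cell \<Rightarrow> nat) \<Rightarrow> cell set" where
  "ones F f = {c \<in> F. f c = 1}"

definition symmetric_filling :: "cell set \<Rightarrow> (cell \<Rightarrow> nat) \<Rightarrow> bool" where
  "symmetric_filling F f \<longleftrightarrow> (\<forall>j i. (j, i) \<in> F \<longrightarrow> f (j, i) = f (i, j))"

definition at_most_one_per_row :: "cell set \<Rightarrow> (cell \<Rightarrow> nat) \<Rightarrow> bool" where
  "at_most_one_per_row F f \<longleftrightarrow>
     (\<forall>i j k. (j, i) \<in> ones F f \<longrightarrow> (k, i) \<in> ones F f \<longrightarrow> j = k)"

definition at_most_one_per_column :: "cell set \<Rightarrow> (cell \<Rightarrow> nat) \<Rightarrow> bool" where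
  "at_most_one_per_column F f \<longleftrightarrow>
     (\<forall>j i k. (j, i) \<in> ones F f \<longrightarrow> (j, k) \<in> ones F f \<longrightarrow> i = k)"

definition NE_chain :: "cell set \<Rightarrow> (cell \<Rightarrow> nat) \<Rightarrow> cell list \<Rightarrow> bool" where
  "NE_chain F f cs \<longleftrightarrow> set cs \<subseteq> ones F f \<and>
     successively (\<lambda>(j, i) (j', i'). j < j' \<and> i < i') cs"

definition SE_chain :: "cell set \<Rightarrow> (cell \<Rightarrow> nat) \<Rightarrow> cell list \<Rightarrow> bool" where
  "SE_chain F f cs \<longleftrightarrow> set cs \<subseteq> ones F f \<and>
     successively (\<lambda>(j, i) (j', i'). j < j' \<and> i' < i) cs"

definition enclosing_rectangle :: "cell list \<Rightarrow> cell set" where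
  "enclosing_rectangle cs =
     (if cs = [] then {}
      else {min (fst (hd cs)) (fst (last cs)) .. max (fst (hd cs)) (fst (last cs))} \<times>
           {min (snd (hd cs)) (snd (last cs)) .. max (snd (hd cs)) (snd (last cs))})"

text \<open>The empty list is a chain of length 0 with empty enclosing rectangle, so both maxima
  below are taken over nonempty sets; they are 0 exactly for the all-zero filling.\<close>

definition longest_NE :: "cell set \<Rightarrow> (cell \<Rightarrow> nat) \<Rightarrow> nat" where
  "longest_NE F f = Max (length ` {cs. NE_chain F f cs})"

definition longest_SE :: "cell set \<Rightarrow> (cell \<Rightarrow> nat) \<Rightarrow> nat" where
  "longest_SE F f = Max (length ` {cs. SE_chain F f cs \<and> enclosing_rectangle cs \<subseteq> F})"

definition N_sym :: "cell set \<Rightarrow> nat \<Rightarrow> nat \<Rightarrow> nat \<Rightarrow> nat" where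
  "N_sym F n s t = card {f \<in> fillings F.
     symmetric_filling F f \<and> card (ones F f) = n \<and>
     at_most_one_per_row F f \<and> at_most_one_per_column F f \<and>
     longest_NE F f = s \<and> longest_SE F f = t}"

end

theory Submission
  imports Defs
begin

text \<open>A filling with at most one 1 in each row and column is encoded by Fomin's growth diagram, which
  attaches to every vertex \<open>(a, b)\<close> the Robinson--Schensted shape of the ones in
  \<open>{1..a} \<times> {1..b}\<close>.  The first row of that shape is the length of a longest NE-chain there and its
  number of rows the length of a longest SE-chain.  Fomin's local rule is invertible, so every
  admissible labelling of the boundary of \<open>F\<close> by partitions comes from exactly one filling.
  Conjugating the labels on the boundary therefore induces a bijection on fillings that exchanges
  the two statistics.  It keeps the set of nonempty rows, hence the number of ones, and it respects
  symmetry because the local rule is invariant under reflection in the diagonal.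

  The \<open>k\<close>-th row of the shapes is the NE-chain statistic of the \<open>k\<close>-fold derived point set in the
  sense of Viennot.  The statement on SE-chains reduces to the fact that points of \<open>P\<close>
  and of its derived set interleave along SE-chains, so that passing to the derived set shortens the
  longest SE-chain by exactly one.\<close>

section \<open>Level lines of a partial permutation\<close>

definition partial_perm :: "cell set \<Rightarrow> bool" where
  "partial_perm P \<longleftrightarrow> (\<forall>x y. (x, y) \<in> P \<longrightarrow> 0 < x \<and> 0 < y) \<and>
     (\<forall>x y y'. (x, y) \<in> P \<longrightarrow> (x, y') \<in> P \<longrightarrow> y = y') \<and>
     (\<forall>x x' y. (x, y) \<in> P \<longrightarrow> (x', y) \<in> P \<longrightarrow> x = x')"

lemma partial_permD:
  assumes "partial_perm P"
  shows partial_perm_pos: "(x, y) \<in> P \<Longrightarrow> 0 < x \<and> 0 < y"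
    and partial_perm_col: "(x, y) \<in> P \<Longrightarrow> (x, y') \<in> P \<Longrightarrow> y = y'"
    and partial_perm_row: "(x, y) \<in> P \<Longrightarrow> (x', y) \<in> P \<Longrightarrow> x = x'"
  using assms unfolding partial_perm_def by blast+

lemma partial_perm_converse: "partial_perm (P\<inverse>) \<longleftrightarrow> partial_perm P"
  unfolding partial_perm_def by auto

lemma partial_perm_subset: "partial_perm P \<Longrightarrow> Q \<subseteq> P \<Longrightarrow> partial_perm Q"
  unfolding partial_perm_def by blast

text \<open>Intended as the length of a longest NE-chain in the rectangle below
  \<open>(a, b)\<close>. A point at the corner is always worth taking, since one extra row or column
  lengthens an NE-chain by at most one. The recursion is the first row of Fomin's local
  rule.\<close>

fun ne_length :: "cell set \<Rightarrow> nat \<Rightarrow> nat \<Rightarrow> nat" where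
  "ne_length P 0 b = 0"
| "ne_length P (Suc a) 0 = 0"
| "ne_length P (Suc a) (Suc b) =
     (if (Suc a, Suc b) \<in> P then Suc (ne_length P a b)
      else max (ne_length P a (Suc b)) (ne_length P (Suc a) b))"

lemma ne_length_zero_right [simp]: "ne_length P a 0 = 0"
  by (cases a) auto

text \<open>Reflection in the diagonal: row versions of later column statements are obtained through
  this symmetry.\<close>

lemma ne_length_converse: "ne_length (P\<inverse>) a b = ne_length P b a"
proof (induction a arbitrary: b)
  case (Suc a)
  then show ?case by (induction b) (auto simp: max.commute)
qed simp

lemma ne_length_cong:
  assumes "\<And>x y. x \<le> a \<Longrightarrow> y \<le> b \<Longrightarrow> (x, y) \<in> P \<longleftrightarrow> (x, y) \<in> Q"
  shows "ne_length P a b = ne_length Q a b"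
  using assms by (induction P a b rule: ne_length.induct) auto

text \<open>The column and row bounds need each other: a step along one side of a unit square is
  bounded through both steps on its other sides. Hence one joint induction on
  \<open>a + b\<close>.\<close>

lemma ne_length_steps:
  "ne_length P a b \<le> ne_length P (Suc a) b \<and> ne_length P (Suc a) b \<le> Suc (ne_length P a b) \<and>
   ne_length P a b \<le> ne_length P a (Suc b) \<and> ne_length P a (Suc b) \<le> Suc (ne_length P a b)"
proof (induction "a + b" arbitrary: a b rule: less_induct)
  case less
  have "ne_length P a b \<le> ne_length P (Suc a) b \<and> ne_length P (Suc a) b \<le> Suc (ne_length P a b)"
  proof (cases b)
    case (Suc b')
    then show ?thesis using less[of a b'] by auto
  qed simp
  moreover have "ne_length P a b \<le> ne_length P a (Suc b) \<and>
      ne_length P a (Suc b) \<le> Suc (ne_length P a b)"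
  proof (cases a)
    case (Suc a')
    then show ?thesis using less[of a' b] by auto
  qed simp
  ultimately show ?case by simp
qed

lemmas ne_length_step_col = ne_length_steps[THEN conjunct1]
  ne_length_steps[THEN conjunct2, THEN conjunct1]
lemmas ne_length_step_row = ne_length_steps[THEN conjunct2, THEN conjunct2, THEN conjunct1]
  ne_length_steps[THEN conjunct2, THEN conjunct2, THEN conjunct2]

lemma ne_length_mono:
  assumes "a \<le> a'" "b \<le> b'"
  shows "ne_length P a b \<le> ne_length P a' b'"
proof -
  have "ne_length P a b \<le> ne_length P a' b"
    using assms(1) by (induction rule: dec_induct) (auto intro: order_trans ne_length_step_col)
  also have "\<dots> \<le> ne_length P a' b'"
    using assms(2) by (induction rule: dec_induct) (auto intro: order_trans ne_length_step_row)
  finally show ?thesis .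
qed

text \<open>The sets \<open>{(a, b). v \<le> ne_length P a b}\<close> are bounded by staircases whose outer corners
  are the points of \<open>P\<close>; the derived set consists of their inner corners.  This is Viennot's
  geometric form of one row of the Robinson--Schensted correspondence.\<close>

definition derived :: "cell set \<Rightarrow> cell set" where
  "derived P = {(Suc a, Suc b) | a b. ne_length P a (Suc b) = Suc (ne_length P a b) \<and>
     ne_length P (Suc a) b = Suc (ne_length P a b)}"

lemma Suc_mem_derived:
  "(Suc a, Suc b) \<in> derived P \<longleftrightarrow> ne_length P a (Suc b) = Suc (ne_length P a b) \<and>
     ne_length P (Suc a) b = Suc (ne_length P a b)"
  unfolding derived_def by auto

lemma derivedE:
  assumes "(x, y) \<in> derived P"
  obtains a b where "x = Suc a" "y = Suc b" "ne_length P a (Suc b) = Suc (ne_length P a b)"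
    "ne_length P (Suc a) b = Suc (ne_length P a b)"
  using assms unfolding derived_def by auto

lemma derived_converse: "derived (P\<inverse>) = (derived P)\<inverse>"
  unfolding derived_def by (auto simp: ne_length_converse)

lemma derived_cong:
  assumes "\<And>x y. x \<le> a \<Longrightarrow> y \<le> b \<Longrightarrow> (x, y) \<in> P \<longleftrightarrow> (x, y) \<in> Q"
    and "u \<le> a" "v \<le> b"
  shows "(u, v) \<in> derived P \<longleftrightarrow> (u, v) \<in> derived Q"
proof -
  have "ne_length P x y = ne_length Q x y" if "x \<le> a" "y \<le> b" for x y
    using assms that by (intro ne_length_cong) auto
  then show ?thesis
    using assms(2,3) unfolding derived_def by auto
qed

section \<open>Columns met by the points and by the derived points\<close>

definition col_hit :: "cell set \<Rightarrow> nat \<Rightarrow> nat \<Rightarrow> bool" where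
  "col_hit P x b \<longleftrightarrow> (\<exists>y\<le>b. (x, y) \<in> P)"

lemma col_hit_Suc: "col_hit P x (Suc b) \<longleftrightarrow> col_hit P x b \<or> (x, Suc b) \<in> P"
  unfolding col_hit_def by (auto simp: le_Suc_eq)

lemma ne_length_not_col_hit:
  "\<not> col_hit P (Suc a) b \<Longrightarrow> ne_length P (Suc a) b = ne_length P a b"
proof (induction b)
  case (Suc b)
  then show ?case using ne_length_step_row(1)[of P a b] by (auto simp: col_hit_Suc)
qed simp

lemma ne_length_not_row_hit:
  "\<not> col_hit (P\<inverse>) (Suc b) a \<Longrightarrow> ne_length P a (Suc b) = ne_length P a b"
  using ne_length_not_col_hit[of "P\<inverse>" b a] by (simp add: ne_length_converse)

lemma derived_imp_col_hit: "(Suc a, Suc b) \<in> derived P \<Longrightarrow> col_hit P (Suc a) b"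
  using ne_length_not_col_hit[of P a b] by (auto simp: Suc_mem_derived)

lemma col_hit_derived:
  assumes "col_hit (derived P) x b"
  shows "col_hit P x b"
proof -
  obtain y where y: "y \<le> b" "(x, y) \<in> derived P"
    using assms by (auto simp: col_hit_def)
  then obtain a d where "x = Suc a" "y = Suc d"
    by (elim derivedE)
  with y derived_imp_col_hit[of a d P] show ?thesis
    unfolding col_hit_def by (meson Suc_leD order_trans)
qed

text \<open>The step across column \<open>Suc a\<close> is switched on by the point of \<open>P\<close> and off by the point of
  \<open>derived P\<close> in that column.\<close>

lemma ne_length_col_iff:
  assumes P: "partial_perm P"
  shows "ne_length P (Suc a) b = Suc (ne_length P a b) \<longleftrightarrow>
     col_hit P (Suc a) b \<and> \<not> col_hit (derived P) (Suc a) b"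
proof (induction b)
  case 0
  then show ?case using partial_perm_pos[OF P] by (auto simp: col_hit_def)
next
  case (Suc b)
  show ?case
  proof (cases "(Suc a, Suc b) \<in> P")
    case True
    have nc: "\<not> col_hit P (Suc a) b" and nr: "\<not> col_hit (P\<inverse>) (Suc b) a"
      by (auto simp: col_hit_def dest: partial_perm_col[OF P True] partial_perm_row[OF P True])
    have "(Suc a, Suc b) \<notin> derived P"
      using nc derived_imp_col_hit by blast
    moreover have "\<not> col_hit (derived P) (Suc a) b"
      using nc col_hit_derived by blast
    ultimately show ?thesis
      using True ne_length_not_row_hit[OF nr] by (simp add: col_hit_Suc)
  next
    case False
    \<comment> \<open>Here the corner value is the maximum of its two neighbours, so a column step
      at height \<open>b\<close> survives to \<open>Suc b\<close> unless the row step is on as well,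
      which is membership in \<open>derived P\<close>.\<close>
    then show ?thesis
      using Suc.IH ne_length_step_col[of P a b] ne_length_step_row[of P a b]
      by (auto simp: col_hit_Suc Suc_mem_derived)
  qed
qed

lemma ne_length_row_iff:
  assumes "partial_perm P"
  shows "ne_length P a (Suc b) = Suc (ne_length P a b) \<longleftrightarrow>
     col_hit (P\<inverse>) (Suc b) a \<and> \<not> col_hit ((derived P)\<inverse>) (Suc b) a"
  using ne_length_col_iff[of "P\<inverse>" b a] assms
  by (simp add: ne_length_converse derived_converse partial_perm_converse)

lemma derived_iff:
  assumes "partial_perm P"
  shows "(Suc a, Suc b) \<in> derived P \<longleftrightarrow>
     col_hit P (Suc a) b \<and> \<not> col_hit (derived P) (Suc a) b \<and>
     col_hit (P\<inverse>) (Suc b) a \<and> \<not> col_hit ((derived P)\<inverse>) (Suc b) a"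
  using ne_length_col_iff[OF assms] ne_length_row_iff[OF assms] by (auto simp: Suc_mem_derived)

text \<open>The lower of two derived points in a column has already switched the column step
  off.\<close>

lemma derived_col_unique:
  assumes P: "partial_perm P" and "(x, y) \<in> derived P" "(x, y') \<in> derived P"
  shows "y = y'"
proof -
  have "\<not> y < y'" if "(x, y) \<in> derived P" "(x, y') \<in> derived P" for y y'
  proof
    assume "y < y'"
    obtain a b where ab: "x = Suc a" "y' = Suc b"
      using \<open>(x, y') \<in> derived P\<close> by (elim derivedE)
    then have "col_hit (derived P) (Suc a) b"
      using that \<open>y < y'\<close> unfolding col_hit_def by (intro exI[of _ y]) auto
    then show False
      using derived_iff[OF P] that ab by blast
  qed
  then show ?thesis using assms by (meson linorder_neqE_nat)
qed

lemma partial_perm_derived: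
  assumes "partial_perm P"
  shows "partial_perm (derived P)"
proof -
  have "x = x'" if "(x, y) \<in> derived P" "(x', y) \<in> derived P" for x x' y
    using derived_col_unique[of "P\<inverse>" y x x'] that assms
    by (simp add: derived_converse partial_perm_converse)
  moreover have "0 < x \<and> 0 < y" if "(x, y) \<in> derived P" for x y
    using that by (elim derivedE) auto
  ultimately show ?thesis
    using derived_col_unique[OF assms] unfolding partial_perm_def by blast
qed

text \<open>This makes the rows of the shapes weakly decreasing. At a derived cell
  \<open>ne_length P\<close> has already risen by one at both neighbours, which pays for the new
  point.\<close>

lemma ne_length_derived_le: "ne_length (derived P) a b \<le> ne_length P a b"
proof (induction a arbitrary: b)
  case (Suc a)
  show ?case
  proof (induction b)
    case (Suc b)
    show ?case
    proof (cases "(Suc a, Suc b) \<in> derived P")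
      case True
      then have "ne_length (derived P) (Suc a) (Suc b) \<le> Suc (ne_length P a b)"
        using Suc.prems \<open>\<And>b. ne_length (derived P) a b \<le> ne_length P a b\<close>[of b] by simp
      also have "\<dots> = ne_length P a (Suc b)"
        using True by (simp add: Suc_mem_derived)
      also have "\<dots> \<le> ne_length P (Suc a) (Suc b)"
        by (rule ne_length_step_col)
      finally show ?thesis .
    next
      case False
      then show ?thesis
        using Suc \<open>\<And>b. ne_length (derived P) a b \<le> ne_length P a b\<close>[of "Suc b"]
          ne_length_step_col(1)[of P a "Suc b"] ne_length_step_row(1)[of P "Suc a" b]
        by (auto simp del: ne_length.simps simp: ne_length.simps(3)[of "derived P"])
    qed
  qed simp
qed simp

section \<open>Chains\<close>

abbreviation ne_less :: "cell \<Rightarrow> cell \<Rightarrow> bool" where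
  "ne_less \<equiv> \<lambda>(j, i) (j', i'). j < j' \<and> i < i'"

abbreviation se_less :: "cell \<Rightarrow> cell \<Rightarrow> bool" where
  "se_less \<equiv> \<lambda>(j, i) (j', i'). j < j' \<and> i' < i"

lemma transp_ne_less: "transp ne_less" and transp_se_less: "transp se_less"
  by (auto intro!: transpI)

lemma ne_chain_length_le:
  assumes P: "partial_perm P"
    and "sorted_wrt ne_less cs" "set cs \<subseteq> P \<inter> {..a} \<times> {..b}"
  shows "length cs \<le> ne_length P a b"
  using assms(2,3)
proof (induction cs arbitrary: a b rule: rev_induct)
  case (snoc c cs)
  obtain x y where c: "c = (Suc x, Suc y)"
    using snoc.prems partial_perm_pos[OF P, of "fst c" "snd c"]
    by (cases c) (auto simp: gr0_conv_Suc)
  have "length cs \<le> ne_length P x y"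
    using snoc.prems c by (intro snoc.IH) (fastforce simp: sorted_wrt_append)+
  then have "length (cs @ [c]) \<le> ne_length P (Suc x) (Suc y)"
    using snoc.prems c by auto
  also have "\<dots> \<le> ne_length P a b"
    using snoc.prems c by (intro ne_length_mono) auto
  finally show ?case .
qed simp

lemma ne_chain_of_ne_length:
  "\<exists>cs. sorted_wrt ne_less cs \<and> set cs \<subseteq> P \<inter> {..a} \<times> {..b} \<and> length cs = ne_length P a b"
proof (induction P a b rule: ne_length.induct)
  case (3 P a b)
  show ?case
  proof (cases "(Suc a, Suc b) \<in> P")
    case True
    with 3(1) obtain cs where "sorted_wrt ne_less cs" "set cs \<subseteq> P \<inter> {..a} \<times> {..b}"
      "length cs = ne_length P a b" by blast
    with True show ?thesis
      by (intro exI[of _ "cs @ [(Suc a, Suc b)]"]) (fastforce simp: sorted_wrt_append)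
  next
    case False
    with 3(2,3) obtain cs cs' where
      "sorted_wrt ne_less cs" "set cs \<subseteq> P \<inter> {..a} \<times> {..Suc b}" "length cs = ne_length P a (Suc b)"
      "sorted_wrt ne_less cs'" "set cs' \<subseteq> P \<inter> {..Suc a} \<times> {..b}" "length cs' = ne_length P (Suc a) b"
      by blast
    with False show ?thesis
      by (intro exI[of _ "if ne_length P a (Suc b) \<le> ne_length P (Suc a) b then cs' else cs"])
        (auto simp: max_def)
  qed
qed auto

text \<open>Initial segments of a longest chain realise every smaller length.\<close>

lemma ne_chain_exists_iff:
  assumes "partial_perm P"
  shows "(\<exists>cs. sorted_wrt ne_less cs \<and> set cs \<subseteq> P \<inter> {..a} \<times> {..b} \<and> length cs = m) \<longleftrightarrow>
     m \<le> ne_length P a b"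
proof
  assume "m \<le> ne_length P a b"
  moreover obtain cs where "sorted_wrt ne_less cs" "set cs \<subseteq> P \<inter> {..a} \<times> {..b}"
    "length cs = ne_length P a b"
    using ne_chain_of_ne_length by blast
  ultimately show "\<exists>cs. sorted_wrt ne_less cs \<and> set cs \<subseteq> P \<inter> {..a} \<times> {..b} \<and> length cs = m"
    using set_take_subset[of m cs] by (intro exI[of _ "take m cs"]) (auto simp: sorted_wrt_take)
qed (use ne_chain_length_le[OF assms] in blast)

section \<open>Interleaving of SE-chains with the derived set\<close>

lemma derived_col_point: "(x, y) \<in> derived P \<Longrightarrow> \<exists>d<y. (x, d) \<in> P"
  using derived_imp_col_hit by (elim derivedE) (fastforce simp: Suc_mem_derived col_hit_def less_Suc_eq_le)

lemma derived_row_point: "(x, y) \<in> derived P \<Longrightarrow> \<exists>c<x. (c, y) \<in> P"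
  using derived_col_point[of y x "P\<inverse>"] by (simp add: derived_converse)

text \<open>In the next two lemmas the column of one point and the row of the other cross in a cell which
  has to lie in \<open>derived P\<close> unless the claim holds.\<close>

lemma derived_between:
  assumes P: "partial_perm P" and "(x, y) \<in> P" "(x', y') \<in> P" "x < x'" "y' < y"
  shows "\<exists>u v. (u, v) \<in> derived P \<and> x < u \<and> u \<le> x' \<and> y' < v \<and> v \<le> y"
proof (cases "(x', y) \<in> derived P")
  case False
  obtain a b where ab: "x' = Suc a" "y = Suc b"
    using assms(4,5) by (metis less_imp_Suc_add)
  have "col_hit P (Suc a) b" "col_hit (P\<inverse>) (Suc b) a"
    using assms ab unfolding col_hit_def by (auto simp: less_Suc_eq_le)
  \<comment> \<open>The cell \<open>(x', y)\<close> has \<open>(x', y')\<close> below it and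
    \<open>(x, y)\<close> to its left, so only an earlier derived point in its column or row can
    keep it out of \<open>derived P\<close>.\<close>
  with False derived_iff[OF P, of a b] ab
  consider v where "v \<le> b" "(Suc a, v) \<in> derived P" | u where "u \<le> a" "(u, Suc b) \<in> derived P"
    by (auto simp: col_hit_def)
  then show ?thesis
  proof cases
    case (1 v)
    \<comment> \<open>A derived point lies above a point of \<open>P\<close> in its column; in
      column \<open>x'\<close> that point is \<open>(x', y')\<close>.\<close>
    then obtain d where "d < v" "(Suc a, d) \<in> P"
      using derived_col_point by blast
    then have "y' < v"
      using partial_perm_col[OF P] assms ab by blast
    with 1 show ?thesis
      using assms ab by (intro exI[of _ "Suc a"] exI[of _ v]) simp
  next
    case (2 u)
    then obtain c where "c < u" "(c, Suc b) \<in> P"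
      using derived_row_point by blast
    then have "x < u"
      using partial_perm_row[OF P] assms ab by blast
    with 2 show ?thesis
      using assms ab by (intro exI[of _ u] exI[of _ "Suc b"]) simp
  qed
qed (use assms in blast)

lemma point_between_derived:
  assumes P: "partial_perm P" and xy: "(x, y) \<in> derived P" "(x', y') \<in> derived P" "x < x'" "y' < y"
  shows "\<exists>u v. (u, v) \<in> P \<and> x \<le> u \<and> u < x' \<and> y' \<le> v \<and> v < y"
proof (rule ccontr)
  assume neg: "\<not> ?thesis"
  obtain c d where cd: "d < y" "(x, d) \<in> P" "c < x'" "(c, y') \<in> P"
    using derived_col_point[OF xy(1)] derived_row_point[OF xy(2)] by blast
  \<comment> \<open>Otherwise \<open>(x, d)\<close> or \<open>(c, y')\<close> would itself be a
    point as claimed.\<close>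
  with neg xy have less: "d < y'" "c < x"
    by (meson le_refl not_le)+
  then obtain a b where ab: "x = Suc a" "y' = Suc b"
    by (metis less_imp_Suc_add)
  have Q: "partial_perm (derived P)"
    using P by (rule partial_perm_derived)
  \<comment> \<open>The crossing cell \<open>(x, y')\<close> meets every condition of
    \<open>derived_iff\<close>: points of \<open>P\<close> precede it in its column and row, while
    the only derived points there, \<open>(x, y)\<close> and \<open>(x', y')\<close>, come later. By
    uniqueness it cannot be derived itself.\<close>
  have "(x, y') \<notin> derived P" "\<not> col_hit (derived P) (Suc a) b" "\<not> col_hit ((derived P)\<inverse>) (Suc b) a"
    using partial_perm_col[OF Q xy(1)] partial_perm_row[OF Q xy(2)] xy(3,4) ab
    by (force simp: col_hit_def)+
  moreover have "col_hit P (Suc a) b" "col_hit (P\<inverse>) (Suc b) a"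
    using cd less ab unfolding col_hit_def by (auto simp: less_Suc_eq_le)
  ultimately show False
    using derived_iff[OF P, of a b] ab by blast
qed

text \<open>One derived point is placed in each gap of the chain. The bounds by \<open>fst p\<close>
  and \<open>snd p\<close> put the tail south-east of the next point that the induction
  adds.\<close>

lemma se_chain_derived:
  assumes P: "partial_perm P"
    and "sorted_wrt se_less (p # ps)" "set (p # ps) \<subseteq> P \<inter> {..a} \<times> {..b}"
  shows "\<exists>qs. sorted_wrt se_less qs \<and> length qs = length ps \<and>
     set qs \<subseteq> derived P \<inter> {fst p<..a} \<times> {..snd p}"
  using assms(2,3)
proof (induction ps arbitrary: p)
  case (Cons p' ps)
  from Cons.prems obtain qs where qs: "sorted_wrt se_less qs" "length qs = length ps"
    "set qs \<subseteq> derived P \<inter> {fst p'<..a} \<times> {..snd p'}"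
    using Cons.IH[of p'] by auto
  obtain u v where uv: "(u, v) \<in> derived P" "fst p < u" "u \<le> fst p'" "snd p' < v" "v \<le> snd p"
    using derived_between[OF P, of "fst p" "snd p" "fst p'" "snd p'"] Cons.prems
    by (auto simp: split_beta)
  have "sorted_wrt se_less ((u, v) # qs)"
    using qs uv by fastforce
  moreover have "set ((u, v) # qs) \<subseteq> derived P \<inter> {fst p<..a} \<times> {..snd p}"
    using qs(3) uv Cons.prems by fastforce
  ultimately show ?case
    using qs(2) by (intro exI[of _ "(u, v) # qs"]) simp
qed simp

text \<open>Each gap yields a point of \<open>P\<close>, and one more lies below the last derived
  point in its column.\<close>

lemma se_chain_of_derived:
  assumes P: "partial_perm P"
    and "sorted_wrt se_less (q # qs)" "set (q # qs) \<subseteq> derived P \<inter> {..a} \<times> {..b}"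
  shows "\<exists>ps. sorted_wrt se_less ps \<and> length ps = Suc (length qs) \<and>
     set ps \<subseteq> P \<inter> {fst q..a} \<times> {..<snd q}"
  using assms(2,3)
proof (induction qs arbitrary: q)
  case Nil
  then obtain d where "d < snd q" "(fst q, d) \<in> P"
    using derived_col_point[of "fst q" "snd q" P] by auto
  then show ?case
    using Nil by (intro exI[of _ "[(fst q, d)]"]) auto
next
  case (Cons q' qs)
  from Cons.prems obtain ps where ps: "sorted_wrt se_less ps" "length ps = Suc (length qs)"
    "set ps \<subseteq> P \<inter> {fst q'..a} \<times> {..<snd q'}"
    using Cons.IH[of q'] by auto
  obtain u v where uv: "(u, v) \<in> P" "fst q \<le> u" "u < fst q'" "snd q' \<le> v" "v < snd q"
    using point_between_derived[OF P, of "fst q" "snd q" "fst q'" "snd q'"] Cons.prems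
    by (auto simp: split_beta)
  have "sorted_wrt se_less ((u, v) # ps)"
    using ps uv by fastforce
  moreover have "set ((u, v) # ps) \<subseteq> P \<inter> {fst q..a} \<times> {..<snd q}"
    using ps(3) uv Cons.prems by fastforce
  ultimately show ?case
    using ps(2) by (intro exI[of _ "(u, v) # ps"]) simp
qed

definition has_se_chain :: "cell set \<Rightarrow> nat \<Rightarrow> nat \<Rightarrow> nat \<Rightarrow> bool" where
  "has_se_chain P a b m \<longleftrightarrow>
     (\<exists>cs. sorted_wrt se_less cs \<and> set cs \<subseteq> P \<inter> {..a} \<times> {..b} \<and> length cs = m)"

lemma has_se_chain_0 [simp]: "has_se_chain P a b 0"
  unfolding has_se_chain_def by auto

lemma has_se_chain_Suc:
  "has_se_chain P a b (Suc m) \<longleftrightarrow> (\<exists>c cs. sorted_wrt se_less (c # cs) \<and>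
     set (c # cs) \<subseteq> P \<inter> {..a} \<times> {..b} \<and> length cs = m)"
  unfolding has_se_chain_def length_Suc_conv by blast

text \<open>A chain of \<open>Suc m\<close> derived points has \<open>m\<close> gaps and two ends,
  which gives \<open>m + 2\<close> points of \<open>P\<close>. The empty derived chain is excluded
  because it exists even when \<open>P\<close> has no point in the rectangle.\<close>

lemma has_se_chain_derived:
  assumes P: "partial_perm P"
  shows "has_se_chain P a b (Suc (Suc m)) \<longleftrightarrow> has_se_chain (derived P) a b (Suc m)"
proof
  assume "has_se_chain P a b (Suc (Suc m))"
  then obtain p ps where ps: "sorted_wrt se_less (p # ps)" "set (p # ps) \<subseteq> P \<inter> {..a} \<times> {..b}"
    "length ps = Suc m"
    unfolding has_se_chain_Suc by blast
  then obtain qs where "sorted_wrt se_less qs" "length qs = length ps"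
    "set qs \<subseteq> derived P \<inter> {fst p<..a} \<times> {..snd p}"
    using se_chain_derived[OF P] by blast
  then show "has_se_chain (derived P) a b (Suc m)"
    unfolding has_se_chain_def using ps(2,3) by (intro exI[of _ qs]) auto
next
  assume "has_se_chain (derived P) a b (Suc m)"
  then obtain q qs where qs: "sorted_wrt se_less (q # qs)"
    "set (q # qs) \<subseteq> derived P \<inter> {..a} \<times> {..b}" "length qs = m"
    unfolding has_se_chain_Suc by blast
  then obtain ps where ps: "sorted_wrt se_less ps" "length ps = Suc (length qs)"
    "set ps \<subseteq> P \<inter> {fst q..a} \<times> {..<snd q}"
    using se_chain_of_derived[OF P] by blast
  \<comment> \<open>The extra first point lies to the left of \<open>q\<close> in its row.\<close>
  obtain c where c: "c < fst q" "(c, snd q) \<in> P"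
    using qs(2) derived_row_point[of "fst q" "snd q" P] by auto
  have "sorted_wrt se_less ((c, snd q) # ps)"
    using ps c by fastforce
  moreover have "set ((c, snd q) # ps) \<subseteq> P \<inter> {..a} \<times> {..b}"
    using ps(3) c qs(2) by fastforce
  ultimately show "has_se_chain P a b (Suc (Suc m))"
    unfolding has_se_chain_def using ps(2) qs(3) by (intro exI[of _ "(c, snd q) # ps"]) simp
qed

text \<open>A single point is an NE-chain and an SE-chain at once.\<close>

lemma has_se_chain_1:
  assumes P: "partial_perm P"
  shows "has_se_chain P a b (Suc 0) \<longleftrightarrow> 0 < ne_length P a b"
proof -
  have "has_se_chain P a b (Suc 0) \<longleftrightarrow> (\<exists>c. c \<in> P \<inter> {..a} \<times> {..b})"
    unfolding has_se_chain_Suc by simp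
  also have "\<dots> \<longleftrightarrow> (\<exists>cs. sorted_wrt ne_less cs \<and> set cs \<subseteq> P \<inter> {..a} \<times> {..b} \<and> length cs = Suc 0)"
  proof
    assume "\<exists>c. c \<in> P \<inter> {..a} \<times> {..b}"
    then obtain c where "c \<in> P \<inter> {..a} \<times> {..b}" ..
    then show "\<exists>cs. sorted_wrt ne_less cs \<and> set cs \<subseteq> P \<inter> {..a} \<times> {..b} \<and> length cs = Suc 0"
      by (intro exI[of _ "[c]"]) simp
  qed (force simp: length_Suc_conv)
  finally show ?thesis
    using ne_chain_exists_iff[OF P, of a b "Suc 0"] by (simp add: Suc_le_eq)
qed

text \<open>The columns of an SE-chain are positive and strictly increase. The bound later shows
  that a shape has finitely many nonzero rows.\<close>

lemma has_se_chain_length_le: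
  assumes P: "partial_perm P" and "has_se_chain P a b m"
  shows "m \<le> a"
proof -
  obtain cs where cs: "sorted_wrt se_less cs" "set cs \<subseteq> P \<inter> {..a} \<times> {..b}" "length cs = m"
    using assms unfolding has_se_chain_def by blast
  have "sorted_wrt (<) (map fst cs)"
    unfolding sorted_wrt_map using cs(1) by (rule sorted_wrt_mono_rel[rotated]) auto
  then have "m = card (fst ` set cs)"
    using cs(3) distinct_card[of "map fst cs"] by (simp add: strict_sorted_iff)
  also have "\<dots> \<le> card {1..a}"
    using cs(2) partial_perm_pos[OF P] by (intro card_mono) fastforce+
  finally show ?thesis by simp
qed

section \<open>The shapes of the growth diagram\<close>

definition shape :: "cell set \<Rightarrow> nat \<Rightarrow> nat \<Rightarrow> nat \<Rightarrow> nat" where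
  "shape P a b k = ne_length ((derived ^^ k) P) a b"

lemma shape_0: "shape P a b 0 = ne_length P a b"
  and shape_Suc: "shape P a b (Suc k) = shape (derived P) a b k"
  by (simp_all add: shape_def funpow_swap1)

lemma partial_perm_funpow: "partial_perm P \<Longrightarrow> partial_perm ((derived ^^ k) P)"
  by (induction k) (auto intro: partial_perm_derived)

text \<open>Each derivation shortens an SE-chain by one, so \<open>Suc m\<close> points come down to
  a single point of the \<open>m\<close>-th derived set.\<close>

lemma has_se_chain_iff_shape:
  assumes "partial_perm P"
  shows "has_se_chain P a b (Suc m) \<longleftrightarrow> 0 < shape P a b m"
  using assms
  by (induction m arbitrary: P)
    (auto simp: has_se_chain_1 shape_0 shape_Suc has_se_chain_derived partial_perm_derived)

definition partition :: "(nat \<Rightarrow> nat) \<Rightarrow> bool" where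
  "partition \<mu> \<longleftrightarrow> antimono \<mu> \<and> finite {k. 0 < \<mu> k}"

lemma partition_shape:
  assumes "partial_perm P"
  shows "partition (shape P a b)"
proof -
  have "{k. 0 < shape P a b k} \<subseteq> {..a}"
    using has_se_chain_iff_shape[OF assms] has_se_chain_length_le[OF assms]
    by (auto intro: Suc_leD)
  moreover have "antimono (shape P a b)"
    by (rule antimonoI, rule lift_Suc_antimono_le[of "shape P a b"])
      (simp_all add: shape_def ne_length_derived_le)
  ultimately show ?thesis
    unfolding partition_def using finite_subset by blast
qed

lemma shape_converse: "shape (P\<inverse>) a b = shape P b a"
proof
  show "shape (P\<inverse>) a b k = shape P b a k" for k
    by (induction k arbitrary: P)
      (simp_all add: shape_0 shape_Suc ne_length_converse derived_converse)
qed

text \<open>This locality lets a corner cell be emptied or filled without changing the labels at the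
  other boundary vertices.\<close>

lemma shape_cong:
  assumes "\<And>x y. x \<le> a \<Longrightarrow> y \<le> b \<Longrightarrow> (x, y) \<in> P \<longleftrightarrow> (x, y) \<in> Q"
  shows "shape P a b = shape Q a b"
proof
  show "shape P a b k = shape Q a b k" for k
    using assms
  proof (induction k arbitrary: P Q)
    case 0
    then show ?case unfolding shape_0 by (rule ne_length_cong)
  next
    case (Suc k)
    show ?case
      unfolding shape_Suc by (rule Suc.IH, rule derived_cong[OF Suc.prems])
  qed
qed

lemma shape_axis: "a = 0 \<or> b = 0 \<Longrightarrow> shape P a b = (\<lambda>_. 0)"
  by (auto simp: shape_def)

text \<open>Equality is included, since a new row or column may contain no point.\<close>

definition adds_box :: "(nat \<Rightarrow> nat) \<Rightarrow> (nat \<Rightarrow> nat) \<Rightarrow> bool" where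
  "adds_box \<mu> \<nu> \<longleftrightarrow> \<nu> = \<mu> \<or> (\<exists>k. \<nu> = \<mu>(k := Suc (\<mu> k)))"

lemma shape_col_step:
  assumes "partial_perm P"
  shows "shape P (Suc a) b k = shape P a b k +
     (if col_hit ((derived ^^ k) P) (Suc a) b \<and> \<not> col_hit ((derived ^^ Suc k) P) (Suc a) b
      then 1 else 0)"
  using ne_length_col_iff[OF partial_perm_funpow[OF assms, of k], of a b]
    ne_length_step_col[of "(derived ^^ k) P" a b]
  by (auto simp: shape_def)

lemma col_hit_funpow_antimono:
  assumes "j \<le> k" "col_hit ((derived ^^ k) P) x b"
  shows "col_hit ((derived ^^ j) P) x b"
  using assms by (induction rule: dec_induct) (auto intro: col_hit_derived)

text \<open>Row \<open>k\<close> grows when the column is hit by the \<open>k\<close>-th but not by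
  the next derived set. Hits only get lost as \<open>k\<close> increases, so this happens for at
  most one \<open>k\<close>.\<close>

lemma adds_box_shape_col:
  assumes P: "partial_perm P"
  shows "adds_box (shape P a b) (shape P (Suc a) b)"
proof (cases "\<exists>k. col_hit ((derived ^^ k) P) (Suc a) b \<and> \<not> col_hit ((derived ^^ Suc k) P) (Suc a) b")
  case True
  then obtain k where k: "col_hit ((derived ^^ k) P) (Suc a) b"
    "\<not> col_hit ((derived ^^ Suc k) P) (Suc a) b" by blast
  have "\<not> (col_hit ((derived ^^ j) P) (Suc a) b \<and> \<not> col_hit ((derived ^^ Suc j) P) (Suc a) b)"
    if "j \<noteq> k" for j
    using that k col_hit_funpow_antimono[of "Suc j" k P "Suc a" b]
      col_hit_funpow_antimono[of "Suc k" j P "Suc a" b]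
    by (meson Suc_leI linorder_neqE_nat)
  then have "shape P (Suc a) b j = ((shape P a b)(k := Suc (shape P a b k))) j" for j
    using shape_col_step[OF P, of a b j] k by (cases "j = k") auto
  then show ?thesis
    unfolding adds_box_def by blast
next
  case False
  then have "shape P (Suc a) b j = shape P a b j" for j
    using shape_col_step[OF P, of a b j] by auto
  then show ?thesis
    unfolding adds_box_def by blast
qed

text \<open>If the column were hit and no row grew, every derived set would hit it, and infinitely
  many rows would be nonzero.\<close>

lemma shape_col_eq_iff:
  assumes P: "partial_perm P"
  shows "shape P (Suc a) b = shape P a b \<longleftrightarrow> \<not> col_hit P (Suc a) b"
proof
  assume eq: "shape P (Suc a) b = shape P a b"
  show "\<not> col_hit P (Suc a) b"
  proof
    assume hit: "col_hit P (Suc a) b"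
    have all: "col_hit ((derived ^^ k) P) (Suc a) b" for k
    proof (induction k)
      case (Suc k)
      then show ?case
        using shape_col_step[OF P, of a b k] eq by (auto split: if_splits)
    qed (simp add: hit)
    have "0 < shape P (Suc a) b k" for k
    proof -
      obtain y where "y \<le> b" "(Suc a, y) \<in> (derived ^^ k) P"
        using all unfolding col_hit_def by blast
      then have "has_se_chain ((derived ^^ k) P) (Suc a) b (Suc 0)"
        unfolding has_se_chain_def by (intro exI[of _ "[(Suc a, y)]"]) simp
      then show ?thesis
        using has_se_chain_1[OF partial_perm_funpow[OF P]] by (simp add: shape_def)
    qed
    then show False
      using partition_shape[OF P, of "Suc a" b] by (simp add: partition_def)
  qed
next
  assume "\<not> col_hit P (Suc a) b"
  then have "\<not> col_hit ((derived ^^ k) P) (Suc a) b" for k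
    using col_hit_funpow_antimono[of 0 k P] by auto
  then show "shape P (Suc a) b = shape P a b"
    using shape_col_step[OF P, of a b] by (intro ext) simp
qed

lemma adds_box_shape_row:
  "partial_perm P \<Longrightarrow> adds_box (shape P a b) (shape P a (Suc b))"
  using adds_box_shape_col[of "P\<inverse>" b a] by (simp add: shape_converse partial_perm_converse)

lemma shape_row_eq_iff:
  "partial_perm P \<Longrightarrow> shape P a (Suc b) = shape P a b \<longleftrightarrow> \<not> col_hit (P\<inverse>) (Suc b) a"
  using shape_col_eq_iff[of "P\<inverse>" b a] by (simp add: shape_converse partial_perm_converse)

section \<open>Fomin's local rule\<close>

text \<open>The four shapes at the corners of a cell: \<open>\<rho>\<close> south-west, \<open>\<mu>\<close> north-west, \<open>\<nu>\<close> south-east,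
  \<open>\<kappa>\<close> north-east; \<open>z\<close> tells whether the cell contains a point.\<close>

definition local_rule ::
  "bool \<Rightarrow> (nat \<Rightarrow> nat) \<Rightarrow> (nat \<Rightarrow> nat) \<Rightarrow> (nat \<Rightarrow> nat) \<Rightarrow> (nat \<Rightarrow> nat) \<Rightarrow> bool" where
  "local_rule z \<rho> \<mu> \<nu> \<kappa> \<longleftrightarrow> adds_box \<rho> \<mu> \<and> adds_box \<rho> \<nu> \<and> (z \<longrightarrow> \<mu> = \<rho> \<and> \<nu> = \<rho>) \<and>
     \<kappa> 0 = (if z then Suc (\<rho> 0) else max (\<mu> 0) (\<nu> 0)) \<and>
     (\<forall>k. \<kappa> (Suc k) = (if \<mu> k = Suc (\<rho> k) \<and> \<nu> k = Suc (\<rho> k) then Suc (\<rho> (Suc k))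
        else max (\<mu> (Suc k)) (\<nu> (Suc k))))"

text \<open>Row \<open>k\<close> of the rule is the recursion of \<open>ne_length\<close> for the
  \<open>k\<close>-th derived set. A cell lying in the next derived set is a box bumped from row
  \<open>k\<close> to row \<open>Suc k\<close>.\<close>

lemma local_rule_shape:
  assumes P: "partial_perm P"
  shows "local_rule ((Suc a, Suc b) \<in> P) (shape P a b) (shape P a (Suc b))
     (shape P (Suc a) b) (shape P (Suc a) (Suc b))"
proof -
  have "shape P a (Suc b) = shape P a b \<and> shape P (Suc a) b = shape P a b"
    if "(Suc a, Suc b) \<in> P"
    unfolding shape_col_eq_iff[OF P] shape_row_eq_iff[OF P]
    by (auto simp: col_hit_def dest: partial_perm_col[OF P that] partial_perm_row[OF P that])
  moreover have "(Suc a, Suc b) \<in> (derived ^^ Suc k) P \<longleftrightarrow>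
      shape P a (Suc b) k = Suc (shape P a b k) \<and> shape P (Suc a) b k = Suc (shape P a b k)" for k
    by (simp add: shape_def Suc_mem_derived)
  moreover have "shape P (Suc a) (Suc b) k = (if (Suc a, Suc b) \<in> (derived ^^ k) P
      then Suc (shape P a b k) else max (shape P a (Suc b) k) (shape P (Suc a) b k))" for k
    by (simp add: shape_def)
  ultimately show ?thesis
    unfolding local_rule_def using adds_box_shape_col[OF P] adds_box_shape_row[OF P]
    by (simp del: funpow.simps add: funpow_0)
qed

lemma local_rule_functional:
  assumes "local_rule z \<rho> \<mu> \<nu> \<kappa>" "local_rule z \<rho> \<mu> \<nu> \<kappa>'"
  shows "\<kappa> = \<kappa>'"
proof
  show "\<kappa> k = \<kappa>' k" for k
    using assms unfolding local_rule_def by (cases k) presburger+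
qed

text \<open>The classical cases of the rule. In the first, \<open>\<mu>\<close> and
  \<open>\<nu>\<close> are distinct extensions of \<open>\<rho>\<close> by at most one box, so
  \<open>\<rho>\<close> is their intersection.\<close>

lemma local_rule_cases:
  assumes "local_rule z \<rho> \<mu> \<nu> \<kappa>"
  obtains (different) "\<mu> \<noteq> \<nu>" "\<not> z" "\<rho> = (\<lambda>k. min (\<mu> k) (\<nu> k))"
    | (point) "\<mu> = \<nu>" "\<rho> = \<mu>" z "\<kappa> = \<mu>(0 := Suc (\<mu> 0))"
    | (still) "\<mu> = \<nu>" "\<rho> = \<mu>" "\<not> z" "\<kappa> = \<mu>"
    | (bump) k where "\<mu> = \<nu>" "\<mu> = \<rho>(k := Suc (\<rho> k))" "\<not> z" "\<kappa> = \<mu>(Suc k := Suc (\<mu> (Suc k)))"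
proof (cases "\<mu> = \<nu>")
  case False
  have "\<not> z" using assms False unfolding local_rule_def by blast
  moreover have "\<rho> = (\<lambda>k. min (\<mu> k) (\<nu> k))"
    using assms False unfolding local_rule_def adds_box_def by (auto simp: fun_eq_iff)
  ultimately show ?thesis using False different by blast
next
  case True
  show ?thesis
  proof (cases "\<mu> = \<rho>")
    case eq: True
    show ?thesis
    proof (cases z)
      case z: True
      have "\<kappa> k = (\<mu>(0 := Suc (\<mu> 0))) k" for k
        using assms True eq z unfolding local_rule_def by (cases k) auto
      then show ?thesis using True eq z point by blast
    next
      case z: False
      have "\<kappa> k = \<mu> k" for k
        using assms True eq z unfolding local_rule_def by (cases k) auto
      then show ?thesis using True eq z still by blast
    qed
  next
    case neq: False
    then obtain k where k: "\<mu> = \<rho>(k := Suc (\<rho> k))"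
      using assms unfolding local_rule_def adds_box_def by blast
    have z: "\<not> z" using assms neq unfolding local_rule_def by blast
    have "\<kappa> j = (\<mu>(Suc k := Suc (\<mu> (Suc k)))) j" for j
      using assms True k z unfolding local_rule_def by (cases j) auto
    then show ?thesis using True k z bump by blast
  qed
qed

text \<open>If \<open>\<mu>\<close> and \<open>\<nu>\<close> differ, their minimum is
  \<open>\<rho>\<close>. If they agree, the row in which \<open>\<kappa>\<close> exceeds them
  separates the other cases and shows where \<open>\<rho>\<close> lacks a box.\<close>

lemma local_rule_backward_unique:
  assumes "local_rule z \<rho> \<mu> \<nu> \<kappa>" "local_rule z' \<rho>' \<mu> \<nu> \<kappa>"
  shows "z = z' \<and> \<rho> = \<rho>'"
proof -
  have upd: "j = k" if "\<mu>(j := Suc (\<mu> j)) = \<mu>(k := Suc (\<mu> k))" for j k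
    using that by (metis fun_upd_other fun_upd_same n_not_Suc_n)
  have nupd: "\<mu>(j := Suc (\<mu> j)) \<noteq> \<mu>" for j
    by (metis fun_upd_same n_not_Suc_n)
  show ?thesis
    using assms(1)
  proof (cases rule: local_rule_cases)
    case different
    with assms(2) show ?thesis by (cases rule: local_rule_cases) auto
  next
    case point
    from assms(2) show ?thesis
    proof (cases rule: local_rule_cases)
      case (bump k)
      then show ?thesis using point upd[of 0 "Suc k"] by auto
    qed (use point nupd in metis)+
  next
    case still
    from assms(2) show ?thesis
      by (cases rule: local_rule_cases) (use still nupd in metis)+
  next
    case (bump k)
    from assms(2) show ?thesis
    proof (cases rule: local_rule_cases)
      case different
      then show ?thesis using bump by blast
    next
      case point
      then show ?thesis using bump upd[of "Suc k" 0] by auto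
    next
      case still
      then show ?thesis using bump nupd by metis
    next
      case (bump k')
      then have "k = k'" using \<open>\<kappa> = \<mu>(Suc k := Suc (\<mu> (Suc k)))\<close> upd[of "Suc k" "Suc k'"] by auto
      then have "\<rho>(k := Suc (\<rho> k)) = \<rho>'(k := Suc (\<rho>' k))"
        using bump(2) \<open>\<mu> = \<rho>(k := Suc (\<rho> k))\<close> by simp
      then have "\<rho> j = \<rho>' j" for j
        by (cases "j = k") (metis fun_upd_same nat.inject, metis fun_upd_other)
      then show ?thesis using bump \<open>\<not> z\<close> by blast
    qed
  qed
qed

text \<open>For \<open>\<mu> = \<nu>\<close>, a box of \<open>\<kappa>\<close> added in row 0 comes
  from a point, and one in row \<open>Suc j\<close> was bumped out of row \<open>j\<close>; for
  \<open>\<mu> \<noteq> \<nu>\<close> the intersection serves as \<open>\<rho>\<close>.\<close>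

lemma local_rule_backward_exists:
  assumes part: "partition \<mu>" "partition \<nu>" "partition \<kappa>"
    and add: "adds_box \<mu> \<kappa>" "adds_box \<nu> \<kappa>"
  shows "\<exists>z \<rho>. partition \<rho> \<and> local_rule z \<rho> \<mu> \<nu> \<kappa>"
proof (cases "\<mu> = \<nu>")
  case False
  let ?\<rho> = "\<lambda>k. min (\<mu> k) (\<nu> k)"
  have "antimono ?\<rho>"
    using part unfolding partition_def by (auto simp: antimono_def min_le_iff_disj)
  moreover have "finite {k. 0 < ?\<rho> k}"
    using part(1) unfolding partition_def by (auto elim: rev_finite_subset)
  moreover have "local_rule False ?\<rho> \<mu> \<nu> \<kappa>"
  proof -
    have "(\<forall>i. \<kappa> i = max (\<mu> i) (\<nu> i)) \<and> adds_box ?\<rho> \<mu> \<and> adds_box ?\<rho> \<nu>"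
    proof -
      from add False consider
        (left) k where "\<mu> = \<nu>(k := Suc (\<nu> k))" "\<kappa> = \<mu>"
        | (right) k where "\<nu> = \<mu>(k := Suc (\<mu> k))" "\<kappa> = \<nu>"
        | (both) j k where "\<kappa> = \<mu>(j := Suc (\<mu> j))" "\<kappa> = \<nu>(k := Suc (\<nu> k))"
        unfolding adds_box_def by blast
      then show ?thesis
      proof cases
        case left
        then have "?\<rho> = \<nu>" by auto
        with left show ?thesis unfolding adds_box_def by auto
      next
        case right
        then have "?\<rho> = \<mu>" by auto
        with right show ?thesis unfolding adds_box_def by auto
      next
        case both
        then have eq: "\<mu>(j := Suc (\<mu> j)) = \<nu>(k := Suc (\<nu> k))" by simp
        have "j \<noteq> k"
        proof
          assume "j = k"
          then have "\<mu> i = \<nu> i" for i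
            using fun_cong[OF eq, of i] by (cases "i = k") auto
          then show False using False by blast
        qed
        have jk: "\<nu> j = Suc (\<mu> j)" "\<mu> k = Suc (\<nu> k)"
          using fun_cong[OF eq, of j] fun_cong[OF eq, of k] \<open>j \<noteq> k\<close> by auto
        have other: "\<mu> i = \<nu> i" if "i \<noteq> j" "i \<noteq> k" for i
          using fun_cong[OF eq, of i] that by auto
        have "\<mu> i = (?\<rho>(k := Suc (?\<rho> k))) i" "\<nu> i = (?\<rho>(j := Suc (?\<rho> j))) i"
          "\<kappa> i = max (\<mu> i) (\<nu> i)" for i
          using both jk other[of i] \<open>j \<noteq> k\<close> by (cases "i = j"; cases "i = k"; auto)+
        then show ?thesis unfolding adds_box_def by blast
      qed
    qed
    then show ?thesis
      unfolding local_rule_def by (auto simp: min_def)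
  qed
  ultimately show ?thesis
    unfolding partition_def by blast
next
  case eq: True
  show ?thesis
  proof (cases "\<kappa> = \<mu>")
    case True
    then have "local_rule False \<mu> \<mu> \<nu> \<kappa>"
      using eq unfolding local_rule_def adds_box_def by auto
    then show ?thesis using part by blast
  next
    case False
    then obtain k where k: "\<kappa> = \<mu>(k := Suc (\<mu> k))"
      using add unfolding adds_box_def by blast
    show ?thesis
    proof (cases k)
      case 0
      then have "local_rule True \<mu> \<mu> \<nu> \<kappa>"
        using eq k unfolding local_rule_def adds_box_def by auto
      then show ?thesis using part by blast
    next
      case (Suc j)
      let ?\<rho> = "\<mu>(j := \<mu> j - 1)"
      \<comment> \<open>As \<open>\<kappa>\<close> is a partition, row \<open>j\<close> of
        \<open>\<mu>\<close> is strictly longer than row \<open>Suc j\<close>. So it can lose a box,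
        and \<open>\<mu> j - 1\<close> is a genuine subtraction.\<close>
      have "\<kappa> (Suc j) \<le> \<kappa> j"
        using part(3) unfolding partition_def antimono_def by simp
      then have j: "Suc (\<mu> (Suc j)) \<le> \<mu> j"
        using k Suc by simp
      have "?\<rho> (Suc i) \<le> ?\<rho> i" for i
        using j part(1) unfolding partition_def antimono_def 
        by (cases "i = j") (auto intro: order_trans[OF diff_le_self])
      then have "antimono ?\<rho>"
        using lift_Suc_antimono_le[of ?\<rho>] by (intro antimonoI) blast
      moreover have "finite {i. 0 < ?\<rho> i}"
        using part(1) unfolding partition_def by (auto elim: rev_finite_subset)
      moreover have "local_rule False ?\<rho> \<mu> \<nu> \<kappa>"
      proof -
        have "\<mu> = ?\<rho>(j := Suc (?\<rho> j))" using j by auto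
        then have "adds_box ?\<rho> \<mu>" unfolding adds_box_def by blast
        then show ?thesis
          unfolding local_rule_def using eq k Suc j by auto
      qed
      ultimately show ?thesis
        unfolding partition_def by blast
    qed
  qed
qed

section \<open>Conjugate partitions\<close>

definition conjugate :: "(nat \<Rightarrow> nat) \<Rightarrow> nat \<Rightarrow> nat" where
  "conjugate \<mu> l = card {k. l < \<mu> k}"

lemma finite_partition_above: "partition \<mu> \<Longrightarrow> finite {k. l < \<mu> k}"
  unfolding partition_def by (auto elim: rev_finite_subset)

text \<open>The set counted by \<open>conjugate\<close> is an initial segment of the row indices
  because \<open>\<mu>\<close> is decreasing. The involution property follows from this
  equivalence.\<close>

lemma less_conjugate_iff:
  assumes "partition \<mu>"
  shows "k < conjugate \<mu> l \<longleftrightarrow> l < \<mu> k"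
proof -
  define n where "n = (LEAST n. \<not> l < \<mu> n)"
  have "\<exists>n. \<not> l < \<mu> n"
    using finite_partition_above[OF assms, of l] by (metis (mono_tags) UNIV_eq_I infinite_UNIV_nat mem_Collect_eq)
  then have n: "\<not> l < \<mu> n"
    unfolding n_def by (rule LeastI_ex)
  have "l < \<mu> j \<longleftrightarrow> j < n" for j
  proof
    assume "l < \<mu> j"
    moreover have "\<mu> j \<le> \<mu> n" if "n \<le> j"
      using assms that unfolding partition_def antimono_def by blast
    ultimately show "j < n" using n by (meson le_less_trans not_le less_le_trans)
  qed (use not_less_Least n_def in blast)
  then show ?thesis
    unfolding conjugate_def by simp
qed

lemma partition_conjugate:
  assumes "partition \<mu>"
  shows "partition (conjugate \<mu>)"
proof -
  have "antimono (conjugate \<mu>)"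
    unfolding conjugate_def
    by (intro antimonoI card_mono finite_partition_above assms) auto
  moreover have "{l. 0 < conjugate \<mu> l} = {..<\<mu> 0}"
    using less_conjugate_iff[OF assms] by auto
  ultimately show ?thesis
    unfolding partition_def by simp
qed

lemma conjugate_conjugate:
  assumes "partition \<mu>"
  shows "conjugate (conjugate \<mu>) = \<mu>"
proof
  show "conjugate (conjugate \<mu>) k = \<mu> k" for k
    unfolding conjugate_def[of "conjugate \<mu>"] less_conjugate_iff[OF assms] by simp
qed

lemma conjugate_zero [simp]: "conjugate (\<lambda>_. 0) = (\<lambda>_. 0)"
  by (simp add: conjugate_def fun_eq_iff)

lemma adds_box_conjugate:
  assumes \<mu>: "partition \<mu>" and "adds_box \<mu> \<nu>"
  shows "adds_box (conjugate \<mu>) (conjugate \<nu>)"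
proof (cases "\<nu> = \<mu>")
  case False
  then obtain k where k: "\<nu> = \<mu>(k := Suc (\<mu> k))"
    using assms unfolding adds_box_def by blast
  \<comment> \<open>The box added to row \<open>k\<close> sits in column \<open>\<mu> k\<close>,
    counted from 0, so it extends that row of the conjugate.\<close>
  have "conjugate \<nu> l = ((conjugate \<mu>)(\<mu> k := Suc (conjugate \<mu> (\<mu> k)))) l" for l
  proof (cases "l = \<mu> k")
    case True
    then have "{j. l < \<nu> j} = insert k {j. l < \<mu> j}" "k \<notin> {j. l < \<mu> j}"
      using k by auto
    then show ?thesis
      using True finite_partition_above[OF \<mu>] by (simp add: conjugate_def)
  next
    case False
    then have "{j. l < \<nu> j} = {j. l < \<mu> j}"
      using k by auto
    then show ?thesis
      using False by (simp add: conjugate_def)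
  qed
  then show ?thesis
    unfolding adds_box_def by blast
qed (simp add: adds_box_def)

section \<open>Labellings of the boundary of a Ferrers shape\<close>

definition down_closed :: "cell set \<Rightarrow> bool" where
  "down_closed F \<longleftrightarrow> (\<forall>x y. (x, y) \<in> F \<longrightarrow> 0 < x \<and> 0 < y) \<and>
     (\<forall>x y u v. (x, y) \<in> F \<longrightarrow> 0 < u \<longrightarrow> u \<le> x \<longrightarrow> 0 < v \<longrightarrow> v \<le> y \<longrightarrow> (u, v) \<in> F)"

lemma down_closed_pos: "down_closed F \<Longrightarrow> (x, y) \<in> F \<Longrightarrow> 0 < x \<and> 0 < y"
  and down_closedD: "down_closed F \<Longrightarrow> (x, y) \<in> F \<Longrightarrow> 0 < u \<Longrightarrow> u \<le> x \<Longrightarrow> 0 < v \<Longrightarrow> v \<le> y \<Longrightarrow> (u, v) \<in> F"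
  unfolding down_closed_def by blast+

text \<open>A vertex \<open>(a, b)\<close> is the north-east corner of the cell \<open>(a, b)\<close>; the boundary is the
  lattice path that separates \<open>F\<close> from its complement, prolonged along both axes.\<close>

definition boundary :: "cell set \<Rightarrow> nat \<Rightarrow> nat \<Rightarrow> bool" where
  "boundary F a b \<longleftrightarrow> (a = 0 \<or> b = 0 \<or> (a, b) \<in> F) \<and> (Suc a, Suc b) \<notin> F"

text \<open>The conditions that shapes satisfy on the boundary, chosen to be stable under
  conjugation; \<open>shape_boundary_surj\<close> shows that they suffice.\<close>

definition labelling :: "cell set \<Rightarrow> (nat \<Rightarrow> nat \<Rightarrow> nat \<Rightarrow> nat) \<Rightarrow> bool" where
  "labelling F g \<longleftrightarrow> (\<forall>a b. boundary F a b \<longrightarrow> partition (g a b)) \<and>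
     (\<forall>a b. boundary F a b \<longrightarrow> a = 0 \<or> b = 0 \<longrightarrow> g a b = (\<lambda>_. 0)) \<and>
     (\<forall>a b. boundary F a b \<longrightarrow> boundary F (Suc a) b \<longrightarrow> adds_box (g a b) (g (Suc a) b)) \<and>
     (\<forall>a b. boundary F a b \<longrightarrow> boundary F a (Suc b) \<longrightarrow> adds_box (g a b) (g a (Suc b)))"

lemma labellingD:
  assumes "labelling F g"
  shows labelling_partition: "boundary F a b \<Longrightarrow> partition (g a b)"
    and labelling_axis: "boundary F a b \<Longrightarrow> a = 0 \<or> b = 0 \<Longrightarrow> g a b = (\<lambda>_. 0)"
    and labelling_col: "boundary F a b \<Longrightarrow> boundary F (Suc a) b \<Longrightarrow> adds_box (g a b) (g (Suc a) b)"
    and labelling_row: "boundary F a b \<Longrightarrow> boundary F a (Suc b) \<Longrightarrow> adds_box (g a b) (g a (Suc b))"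
  using assms unfolding labelling_def by blast+

lemma labelling_conjugate_shape:
  assumes "partial_perm P"
  shows "labelling F (\<lambda>a b. conjugate (shape P a b))"
  unfolding labelling_def
  using assms
  by (auto intro!: partition_conjugate partition_shape adds_box_conjugate adds_box_shape_col
      adds_box_shape_row simp: shape_axis)

section \<open>Peeling a Ferrers shape corner by corner\<close>

locale corner =
  fixes F :: "cell set" and a b :: nat
  assumes down: "down_closed F" and mem: "(Suc a, Suc b) \<in> F"
    and maximal: "(x, y) \<in> F \<Longrightarrow> Suc a \<le> x \<Longrightarrow> Suc b \<le> y \<Longrightarrow> x = Suc a \<and> y = Suc b"
begin

lemma down_closed_remove: "down_closed (F - {(Suc a, Suc b)})"
proof -
  have "(u, v) \<noteq> (Suc a, Suc b)"
    if "(x, y) \<in> F - {(Suc a, Suc b)}" "u \<le> x" "v \<le> y" for x y u v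
    using that maximal by auto
  then show ?thesis
    using down unfolding down_closed_def by blast
qed

lemma boundary_corners:
  "boundary F (Suc a) (Suc b)" "boundary F a (Suc b)" "boundary F (Suc a) b" "\<not> boundary F a b"
  using mem maximal[of "Suc (Suc a)" "Suc (Suc b)"] maximal[of "Suc (Suc a)" "Suc b"]
    maximal[of "Suc a" "Suc (Suc b)"]
    down_closedD[OF down mem, of a "Suc b"] down_closedD[OF down mem, of "Suc a" b]
  unfolding boundary_def by auto

text \<open>Removing the corner cell replaces its north-east vertex by its south-west vertex on the
  boundary.\<close>

lemma boundary_remove:
  "boundary (F - {(Suc a, Suc b)}) u v \<longleftrightarrow>
     boundary F u v \<and> (u, v) \<noteq> (Suc a, Suc b) \<or> u = a \<and> v = b"
  using mem down_closedD[OF down mem, of a b] unfolding boundary_def by auto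

text \<open>Hence the rectangle below any other boundary vertex misses the corner cell.\<close>

lemma boundary_not_beyond:
  assumes "boundary F u v" "(u, v) \<noteq> (Suc a, Suc b)"
  shows "u \<le> a \<or> v \<le> b"
  using assms maximal[of u v] unfolding boundary_def by (auto simp: not_less_eq_eq[symmetric])

end

lemma corner_exists:
  assumes "finite F" "F \<noteq> {}" "down_closed F"
  obtains a b where "corner F a b"
proof -
  \<comment> \<open>A cell with maximal coordinate sum is a corner.\<close>
  obtain c where c: "c \<in> F" "\<And>d. d \<in> F \<Longrightarrow> fst d + snd d \<le> fst c + snd c"
    using assms(1,2) Max_in[of "(\<lambda>c. fst c + snd c) ` F"] Max_ge[of "(\<lambda>c. fst c + snd c) ` F"]
    by (smt (verit, ccfv_threshold) finite_imageI image_iff image_is_empty)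
  have "0 < fst c \<and> 0 < snd c"
    using down_closed_pos[OF assms(3), of "fst c" "snd c"] c(1) by simp
  then obtain a b where ab: "c = (Suc a, Suc b)"
    by (cases c) (auto simp: gr0_conv_Suc)
  have "corner F a b"
  proof
    show "x = Suc a \<and> y = Suc b" if "(x, y) \<in> F" "Suc a \<le> x" "Suc b \<le> y" for x y
      using c(2)[OF that(1)] that ab by simp
  qed (use assms c ab in auto)
  then show ?thesis by (rule that)
qed

text \<open>At a corner, the backward local rule recovers from three boundary labels whether the
  cell is occupied and which label the newly exposed vertex carries; then the smaller shape is
  handled by induction.\<close>

lemma shape_boundary_inj:
  assumes "finite F" "down_closed F" "partial_perm P" "partial_perm Q" "P \<subseteq> F" "Q \<subseteq> F"
    and "\<And>a b. boundary F a b \<Longrightarrow> shape P a b = shape Q a b"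
  shows "P = Q"
  using assms
proof (induction "card F" arbitrary: F P Q rule: less_induct)
  case less
  show ?case
  proof (cases "F = {}")
    case False
    then obtain a b where "corner F a b"
      using corner_exists less.prems by metis
    then interpret corner F a b .
    let ?c = "(Suc a, Suc b)"
    have rule: "local_rule (?c \<in> R) (shape R a b) (shape R a (Suc b)) (shape R (Suc a) b)
      (shape R (Suc a) (Suc b))" if "partial_perm R" for R
      using that by (rule local_rule_shape)
    have c: "?c \<in> P \<longleftrightarrow> ?c \<in> Q" and ab: "shape P a b = shape Q a b"
      using local_rule_backward_unique[OF rule[OF less.prems(3)]] rule[OF less.prems(4)]
        less.prems(7) boundary_corners by auto
    have remove: "shape (R - {?c}) u v = shape R u v"
      if "boundary (F - {?c}) u v" for R u v
    proof (rule shape_cong)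
      show "(x, y) \<in> R - {?c} \<longleftrightarrow> (x, y) \<in> R" if "x \<le> u" "y \<le> v" for x y
        using \<open>boundary (F - {?c}) u v\<close> that boundary_not_beyond[of u v]
        unfolding boundary_remove by auto
    qed
    have "P - {?c} = Q - {?c}"
    proof (rule less.hyps[OF _ _ down_closed_remove])
      show "card (F - {?c}) < card F"
        using mem less.prems(1) by (rule card_Diff1_less[rotated])
      show "shape (P - {?c}) u v = shape (Q - {?c}) u v" if "boundary (F - {?c}) u v" for u v
        using that ab less.prems(7) unfolding remove[OF that] boundary_remove by auto
    qed (use less.prems in \<open>auto intro: partial_perm_subset\<close>)
    then show ?thesis using c by blast
  qed (use less.prems in auto)
qed

text \<open>The backward rule supplies a label for the vertex exposed by removing a corner,
  induction realises the smaller labelling, and the forward rule restores the label at the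
  corner.\<close>

lemma shape_boundary_surj:
  assumes "finite F" "down_closed F" "labelling F g"
  shows "\<exists>P\<subseteq>F. partial_perm P \<and> (\<forall>a b. boundary F a b \<longrightarrow> shape P a b = g a b)"
  using assms
proof (induction "card F" arbitrary: F g rule: less_induct)
  case less
  show ?case
  proof (cases "F = {}")
    case True
    have "shape {} a b = g a b" if "boundary F a b" for a b
      using that labelling_axis[OF less.prems(3) that] True
      by (auto simp: boundary_def shape_axis)
    then show ?thesis
      by (intro exI[of _ "{}"]) (auto simp: partial_perm_def)
  next
    case False
    then obtain a b where "corner F a b"
      using corner_exists less.prems by metis
    then interpret corner F a b .
    let ?c = "(Suc a, Suc b)"
    note corners = boundary_corners
    obtain z \<rho> where \<rho>: "partition \<rho>"
      and rule: "local_rule z \<rho> (g a (Suc b)) (g (Suc a) b) (g (Suc a) (Suc b))"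
      using local_rule_backward_exists[of "g a (Suc b)" "g (Suc a) b" "g (Suc a) (Suc b)"]
        labellingD[OF less.prems(3)] corners by blast
    define h where "h = (\<lambda>u v. if u = a \<and> v = b then \<rho> else g u v)"
    have "labelling (F - {?c}) h"
    proof -
      have add: "adds_box \<rho> (g a (Suc b))" "adds_box \<rho> (g (Suc a) b)"
        using rule unfolding local_rule_def by blast+
      \<comment> \<open>If the exposed vertex is on an axis, so is one of its two neighbours, whose
        zero label leaves no room for a box in \<open>\<rho>\<close>.\<close>
      have zero: "\<rho> = (\<lambda>_. 0)" if "a = 0 \<or> b = 0"
      proof -
        have "adds_box \<rho> (\<lambda>_. 0)"
          using that add labelling_axis[OF less.prems(3)] corners by metis
        then show ?thesis
          unfolding adds_box_def by (auto simp: fun_eq_iff split: if_splits)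
      qed
      \<comment> \<open>The exposed vertex has no boundary neighbour to its left or below it, so
        only the two steps in \<open>add\<close> are new.\<close>
      have no_left: "\<not> boundary F u b" if "Suc u = a" for u
        using down_closedD[OF down mem, of a "Suc b"] that unfolding boundary_def by auto
      have no_below: "\<not> boundary F a v" if "Suc v = b" for v
        using down_closedD[OF down mem, of "Suc a" b] that unfolding boundary_def by auto
      show ?thesis
        using labellingD[OF less.prems(3)] \<rho> add zero no_left no_below corners
        unfolding labelling_def boundary_remove h_def by auto
    qed
    moreover have "card (F - {?c}) < card F"
      using mem less.prems(1) by (rule card_Diff1_less[rotated])
    ultimately obtain P where P: "P \<subseteq> F - {?c}" "partial_perm P"
      and shape_P: "\<And>u v. boundary (F - {?c}) u v \<Longrightarrow> shape P u v = h u v"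
      using less.hyps[OF _ _ down_closed_remove] less.prems(1) by (metis finite_Diff)
    define Q where "Q = (if z then insert ?c P else P)"
    have Q_cong: "shape Q u v = shape P u v" if "u \<le> a \<or> v \<le> b" for u v
      using that by (intro shape_cong) (auto simp: Q_def)
    have shapes: "shape P a b = \<rho>" "shape P a (Suc b) = g a (Suc b)" "shape P (Suc a) b = g (Suc a) b"
      using shape_P corners unfolding boundary_remove by (simp_all add: h_def)
    \<comment> \<open>When a point is added, the rule forces equal labels around the cell, so its
      column below and its row to the left are empty; maximality of the corner excludes points
      beyond.\<close>
    have Q: "partial_perm Q"
    proof (cases z)
      case True
      then have "shape P a (Suc b) = shape P a b" "shape P (Suc a) b = shape P a b"
        using rule shapes unfolding local_rule_def by auto
      then have hit: "\<not> col_hit P (Suc a) b" "\<not> col_hit (P\<inverse>) (Suc b) a"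
        using shape_col_eq_iff[OF P(2)] shape_row_eq_iff[OF P(2)] by auto
      have "(Suc a, y) \<notin> P" for y
        using hit(1) P(1) maximal[of "Suc a" y] by (auto simp: col_hit_def not_less_eq_eq)
      moreover have "(x, Suc b) \<notin> P" for x
        using hit(2) P(1) maximal[of x "Suc b"] by (auto simp: col_hit_def not_less_eq_eq)
      ultimately show ?thesis
        using P(2) True unfolding partial_perm_def Q_def by auto
    qed (use P Q_def in simp)
    have "?c \<in> Q \<longleftrightarrow> z"
      using P(1) by (auto simp: Q_def)
    then have "local_rule z \<rho> (g a (Suc b)) (g (Suc a) b) (shape Q (Suc a) (Suc b))"
      using local_rule_shape[OF Q, of a b] shapes by (simp add: Q_cong)
    then have "shape Q (Suc a) (Suc b) = g (Suc a) (Suc b)"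
      using rule by (rule local_rule_functional)
    moreover have "shape Q u v = g u v" if "boundary F u v" "(u, v) \<noteq> ?c" for u v
    proof -
      have "u \<le> a \<or> v \<le> b"
        using boundary_not_beyond[OF that] .
      then show ?thesis
        using shape_P[of u v] that corners(4) by (auto simp: Q_cong boundary_remove h_def)
    qed
    ultimately have "\<forall>u v. boundary F u v \<longrightarrow> shape Q u v = g u v"
      by auto
    moreover have "Q \<subseteq> F"
      using P(1) mem by (auto simp: Q_def)
    ultimately show ?thesis using Q by blast
  qed
qed

section \<open>Fillings\<close>

lemma boundary_above:
  assumes "finite F" and xy: "x = 0 \<or> y = 0 \<or> (x, y) \<in> F"
  obtains a b where "boundary F a b" "x \<le> a" "y \<le> b"
proof -
  \<comment> \<open>The boundary vertex is found by walking north-east along the diagonal until the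
    next cell leaves the finite set \<open>F\<close>.\<close>
  define k where "k = (LEAST k. (x + Suc k, y + Suc k) \<notin> F)"
  have "inj (\<lambda>k. (x + Suc k, y + Suc k))"
    by (auto simp: inj_def)
  then have "\<exists>k. (x + Suc k, y + Suc k) \<notin> F"
    using assms(1) by (meson finite_subset image_subsetI infinite_UNIV_nat finite_imageD)
  then have out: "(x + Suc k, y + Suc k) \<notin> F"
    unfolding k_def by (rule LeastI_ex)
  have "x + k = 0 \<or> y + k = 0 \<or> (x + k, y + k) \<in> F"
  proof (cases k)
    case (Suc j)
    then show ?thesis
      using not_less_Least[of j "\<lambda>k. (x + Suc k, y + Suc k) \<notin> F"] unfolding k_def by auto
  qed (use xy in simp)
  then have "boundary F (x + k) (y + k)"
    using out unfolding boundary_def by simp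
  then show ?thesis using that by simp
qed

text \<open>The last cell of an NE-chain lies in \<open>F\<close> and dominates the others, so some
  boundary vertex has the whole chain below it.\<close>

lemma lengths_NE_chain:
  assumes "finite F" and P: "partial_perm (ones F f)"
  shows "length ` {cs. NE_chain F f cs} =
     {m. \<exists>a b. boundary F a b \<and> m \<le> shape (ones F f) a b 0}" (is "_ = ?R")
proof -
  let ?P = "ones F f"
  have R: "?R = {m. \<exists>a b cs. boundary F a b \<and> sorted_wrt ne_less cs \<and>
      set cs \<subseteq> ?P \<inter> {..a} \<times> {..b} \<and> length cs = m}"
    using ne_chain_exists_iff[OF P] by (simp add: shape_0)
  have "\<exists>a b. boundary F a b \<and> set cs \<subseteq> {..a} \<times> {..b}"
    if cs: "sorted_wrt ne_less cs" "set cs \<subseteq> ?P" for cs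
  proof (cases cs rule: rev_cases)
    case Nil
    obtain a b where "boundary F a b"
      by (rule boundary_above[OF assms(1), of 0 0]) auto
    with Nil show ?thesis by auto
  next
    case (snoc ds c)
    then have c: "c \<in> F" "\<forall>d\<in>set ds. ne_less d c"
      using cs by (auto simp: ones_def sorted_wrt_append)
    obtain a b where "boundary F a b" "fst c \<le> a" "snd c \<le> b"
      using boundary_above[OF assms(1), of "fst c" "snd c"] c(1) by auto
    then show ?thesis
      using c(2) snoc by (intro exI[of _ a] exI[of _ b]) fastforce
  qed
  then have "NE_chain F f cs \<longleftrightarrow> (\<exists>a b. boundary F a b \<and> sorted_wrt ne_less cs \<and>
      set cs \<subseteq> ?P \<inter> {..a} \<times> {..b})" for cs
    unfolding NE_chain_def successively_conv_sorted_wrt[OF transp_ne_less]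
    by (cases "sorted_wrt ne_less cs \<and> set cs \<subseteq> ?P") auto
  then show ?thesis
    unfolding R by auto
qed

lemma enclosing_rectangle_SE:
  assumes "sorted_wrt se_less cs" "cs \<noteq> []"
  shows "enclosing_rectangle cs = {fst (hd cs)..fst (last cs)} \<times> {snd (last cs)..snd (hd cs)}"
    and "set cs \<subseteq> {..fst (last cs)} \<times> {..snd (hd cs)}"
proof -
  have last: "\<forall>c\<in>set cs. c = last cs \<or> se_less c (last cs)"
    using assms by (cases cs rule: rev_cases) (auto simp: sorted_wrt_append)
  have hd: "\<forall>c\<in>set cs. c = hd cs \<or> se_less (hd cs) c"
    using assms by (cases cs) auto
  have "fst (hd cs) \<le> fst (last cs) \<and> snd (last cs) \<le> snd (hd cs)"
    using hd assms(2) last_in_set[of cs] by (fastforce simp: split_beta)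
  then show "enclosing_rectangle cs = {fst (hd cs)..fst (last cs)} \<times> {snd (last cs)..snd (hd cs)}"
    using assms(2) by (simp add: enclosing_rectangle_def min_absorb1 min_absorb2 max_absorb1 max_absorb2)
  show "set cs \<subseteq> {..fst (last cs)} \<times> {..snd (hd cs)}"
  proof
    show "c \<in> {..fst (last cs)} \<times> {..snd (hd cs)}" if "c \<in> set cs" for c
      using last[rule_format, OF that] hd[rule_format, OF that] by (auto simp: split_beta mem_Times_iff)
  qed
qed

text \<open>The enclosing rectangle lies in \<open>F\<close> exactly when its north-east corner
  does, that is, when a boundary vertex has the chain below it. The first row of the conjugate
  counts the nonzero rows.\<close>

lemma lengths_SE_chain:
  assumes "finite F" "down_closed F" and P: "partial_perm (ones F f)"
  shows "length ` {cs. SE_chain F f cs \<and> enclosing_rectangle cs \<subseteq> F} =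
     {m. \<exists>a b. boundary F a b \<and> m \<le> conjugate (shape (ones F f) a b) 0}" (is "_ = ?R")
proof -
  let ?P = "ones F f"
  have "has_se_chain ?P a b m \<longleftrightarrow> m \<le> conjugate (shape ?P a b) 0" for a b m
  proof (cases m)
    case (Suc k)
    then show ?thesis
      using has_se_chain_iff_shape[OF P] less_conjugate_iff[OF partition_shape[OF P]]
      by (simp add: Suc_le_eq)
  qed simp
  then have R: "?R = {m. \<exists>a b cs. boundary F a b \<and> sorted_wrt se_less cs \<and>
      set cs \<subseteq> ?P \<inter> {..a} \<times> {..b} \<and> length cs = m}"
    unfolding has_se_chain_def by simp
  have "enclosing_rectangle cs \<subseteq> F \<longleftrightarrow> (\<exists>a b. boundary F a b \<and> set cs \<subseteq> {..a} \<times> {..b})"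
    if cs: "sorted_wrt se_less cs" "set cs \<subseteq> ?P" for cs
  proof (cases "cs = []")
    case True
    obtain a b where "boundary F a b"
      by (rule boundary_above[OF assms(1), of 0 0]) auto
    with True show ?thesis by (auto simp: enclosing_rectangle_def)
  next
    case False
    note rect = enclosing_rectangle_SE[OF cs(1) False]
    have mem: "hd cs \<in> ?P" "last cs \<in> ?P"
      using False cs(2) by auto
    have pos: "0 < fst (hd cs)" "0 < snd (last cs)"
      using mem partial_perm_pos[OF P, of "fst (hd cs)" "snd (hd cs)"]
        partial_perm_pos[OF P, of "fst (last cs)" "snd (last cs)"] by auto
    show ?thesis
    proof
      assume "enclosing_rectangle cs \<subseteq> F"
      moreover have "fst (hd cs) \<le> fst (last cs)" "snd (last cs) \<le> snd (hd cs)"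
        using subsetD[OF rect(2) hd_in_set[OF False]] subsetD[OF rect(2) last_in_set[OF False]]
        by (simp_all add: mem_Times_iff)
      ultimately have "(fst (last cs), snd (hd cs)) \<in> F"
        unfolding rect(1) by auto
      then obtain a b where "boundary F a b" "fst (last cs) \<le> a" "snd (hd cs) \<le> b"
        using boundary_above[OF assms(1)] by metis
      then show "\<exists>a b. boundary F a b \<and> set cs \<subseteq> {..a} \<times> {..b}"
        using rect(2) by (intro exI[of _ a] exI[of _ b]) auto
    next
      assume "\<exists>a b. boundary F a b \<and> set cs \<subseteq> {..a} \<times> {..b}"
      then obtain a b where ab: "boundary F a b" "set cs \<subseteq> {..a} \<times> {..b}" by blast
      \<comment> \<open>Positive coordinates exclude vertices on the axes, so the cell
        \<open>(a, b)\<close> is in \<open>F\<close>.\<close>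
      have le: "fst (last cs) \<le> a" "snd (hd cs) \<le> b" "0 < a" "0 < b"
        using subsetD[OF ab(2) hd_in_set[OF False]] subsetD[OF ab(2) last_in_set[OF False]] pos
        by (simp_all add: mem_Times_iff)
      then have "(a, b) \<in> F"
        using ab(1) unfolding boundary_def by auto
      then show "enclosing_rectangle cs \<subseteq> F"
        unfolding rect(1) using le pos by (auto intro: down_closedD[OF assms(2)])
    qed
  qed
  then have "SE_chain F f cs \<and> enclosing_rectangle cs \<subseteq> F \<longleftrightarrow>
      (\<exists>a b. boundary F a b \<and> sorted_wrt se_less cs \<and> set cs \<subseteq> ?P \<inter> {..a} \<times> {..b})" for cs
    unfolding SE_chain_def successively_conv_sorted_wrt[OF transp_se_less]
    by (cases "sorted_wrt se_less cs \<and> set cs \<subseteq> ?P") auto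
  then show ?thesis
    unfolding R by auto
qed

text \<open>The number of points is the number of nonempty rows. A row is nonempty exactly when the
  labels at the ends of its boundary step differ, and conjugation, being an involution, preserves
  that.\<close>

lemma card_eq_of_conjugate_shapes:
  assumes F: "finite F" "down_closed F" and P: "partial_perm P" "P \<subseteq> F"
    and Q: "partial_perm Q" "Q \<subseteq> F"
    and conj: "\<And>a b. boundary F a b \<Longrightarrow> shape Q a b = conjugate (shape P a b)"
  shows "card Q = card P"
proof -
  have "y \<in> snd ` Q \<longleftrightarrow> y \<in> snd ` P" for y
  proof (cases y)
    case 0
    then show ?thesis
      using partial_perm_pos[OF P(1)] partial_perm_pos[OF Q(1)] by fastforce
  next
    case (Suc b)
    \<comment> \<open>This is the length of row \<open>Suc b\<close> of \<open>F\<close>, possibly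
      0; the vertical boundary step of that row runs from \<open>(a, b)\<close> to
      \<open>(a, Suc b)\<close>.\<close>
    define a where "a = (LEAST a. (Suc a, Suc b) \<notin> F)"
    have "inj (\<lambda>a. (Suc a, Suc b))"
      by (auto simp: inj_def)
    then have "\<exists>a. (Suc a, Suc b) \<notin> F"
      using F(1) by (meson finite_subset image_subsetI infinite_UNIV_nat finite_imageD)
    then have out: "(Suc a, Suc b) \<notin> F"
      unfolding a_def by (rule LeastI_ex)
    have a: "a = 0 \<or> (a, Suc b) \<in> F"
      using not_less_Least[of "a - 1" "\<lambda>a. (Suc a, Suc b) \<notin> F"] unfolding a_def[symmetric]
      by (cases a) auto
    have bd: "boundary F a b" "boundary F a (Suc b)"
      using a out down_closedD[OF F(2), of a "Suc b" a b]
        down_closedD[OF F(2), of "Suc a" "Suc (Suc b)" "Suc a" "Suc b"]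
      unfolding boundary_def by auto
    have hit: "y \<in> snd ` R \<longleftrightarrow> shape R a (Suc b) \<noteq> shape R a b"
      if "partial_perm R" "R \<subseteq> F" for R
    proof -
      have "x \<le> a" if "(x, Suc b) \<in> R" for x
        using down_closedD[OF F(2), of x "Suc b" "Suc a" "Suc b"] out that \<open>R \<subseteq> F\<close>
        by (meson not_less_eq_eq subsetD zero_less_Suc le_refl)
      then show ?thesis
        unfolding shape_row_eq_iff[OF that(1)] col_hit_def using Suc by force
    qed
    have "shape Q a (Suc b) = shape Q a b \<longleftrightarrow> shape P a (Suc b) = shape P a b"
      unfolding conj[OF bd(1)] conj[OF bd(2)]
      using conjugate_conjugate[OF partition_shape[OF P(1)]] by metis
    then show ?thesis
      using hit[OF P] hit[OF Q] by blast
  qed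
  then have "snd ` Q = snd ` P" by blast
  moreover have "card (snd ` R) = card R" if "partial_perm R" for R
    using partial_perm_row[OF that] by (intro card_image) (auto simp: inj_on_def)
  ultimately show ?thesis using P Q by metis
qed

text \<open>The reflection of \<open>Q\<close> has the same boundary labels as \<open>Q\<close>,
  because \<open>P\<close> and \<open>F\<close> are symmetric, so injectivity makes \<open>Q\<close>
  symmetric.\<close>

lemma conjugate_filling_exists:
  assumes F: "finite F" "down_closed F" and sym: "F\<inverse> = F"
    and P: "partial_perm P" "P \<subseteq> F" "P\<inverse> = P"
  shows "\<exists>Q\<subseteq>F. partial_perm Q \<and> Q\<inverse> = Q \<and>
     (\<forall>a b. boundary F a b \<longrightarrow> shape Q a b = conjugate (shape P a b))"
proof -
  obtain Q where Q: "Q \<subseteq> F" "partial_perm Q"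
    and shape: "\<And>a b. boundary F a b \<Longrightarrow> shape Q a b = conjugate (shape P a b)"
    using shape_boundary_surj[OF F labelling_conjugate_shape[OF P(1)]] by blast
  have "shape (Q\<inverse>) a b = shape Q a b" if "boundary F a b" for a b
  proof -
    have "boundary F b a"
      using that sym unfolding boundary_def by blast
    then have "shape (Q\<inverse>) a b = conjugate (shape (P\<inverse>) a b)"
      by (simp add: shape shape_converse)
    then show ?thesis
      using shape[OF that] P(3) by simp
  qed
  moreover have "Q\<inverse> \<subseteq> F" "partial_perm (Q\<inverse>)"
    using Q sym by (auto simp: partial_perm_converse)
  ultimately have "Q\<inverse> = Q"
    using shape_boundary_inj[OF F] Q by blast
  then show ?thesis
    using Q shape by blast
qed

section \<open>Translation between fillings and point sets\<close>

lemma ferrers_shape_down_closed: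
  assumes "ferrers_shape F"
  shows "finite F" "down_closed F"
proof -
  obtain m h where h: "\<forall>j\<in>{1..m}. \<forall>k\<in>{1..m}. j \<le> k \<longrightarrow> h k \<le> (h j :: nat)"
    and F: "F = {(j, i). j \<in> {1..m} \<and> i \<in> {1..h j}}"
    using assms unfolding ferrers_shape_def by blast
  have "F = Sigma {1..m} (\<lambda>j. {1..h j})"
    using F by auto
  then show "finite F" by simp
  have "v \<le> h u" if "0 < u" "u \<le> x" "x \<le> m" "v \<le> y" "y \<le> h x" for u v x y
  proof -
    have "h x \<le> h u" using h that by auto
    then show ?thesis using that by simp
  qed
  then show "down_closed F"
    unfolding down_closed_def F by auto
qed

definition sym_fillings :: "cell set \<Rightarrow> nat \<Rightarrow> nat \<Rightarrow> nat \<Rightarrow> (cell \<Rightarrow> nat) set" where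
  "sym_fillings F n s t = {f \<in> fillings F.
     symmetric_filling F f \<and> card (ones F f) = n \<and>
     at_most_one_per_row F f \<and> at_most_one_per_column F f \<and>
     longest_NE F f = s \<and> longest_SE F f = t}"

lemma partial_perm_ones_iff:
  assumes "down_closed F"
  shows "partial_perm (ones F f) \<longleftrightarrow> at_most_one_per_row F f \<and> at_most_one_per_column F f"
proof -
  have "0 < x \<and> 0 < y" if "(x, y) \<in> ones F f" for x y
    using that down_closed_pos[OF assms] by (auto simp: ones_def)
  then show ?thesis
    unfolding partial_perm_def at_most_one_per_row_def at_most_one_per_column_def by blast
qed

lemma fillings_eq_iff_ones:
  assumes "f \<in> fillings F" "g \<in> fillings F"
  shows "f = g \<longleftrightarrow> ones F f = ones F g"
proof
  assume eq: "ones F f = ones F g"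
  show "f = g"
  proof (rule PiE_ext)
    show "f c = g c" if "c \<in> F" for c
    proof -
      have "f c = 1 \<longleftrightarrow> g c = 1"
        using eq that unfolding ones_def by blast
      moreover have "f c \<in> {0, 1}" "g c \<in> {0, 1}"
        using assms that unfolding fillings_def by auto
      ultimately show ?thesis by auto
    qed
  qed (use assms in \<open>auto simp: fillings_def\<close>)
qed simp

lemma symmetric_filling_iff_ones:
  assumes "symmetric_shape F" "f \<in> fillings F"
  shows "symmetric_filling F f \<longleftrightarrow> (ones F f)\<inverse> = ones F f"
proof -
  have "f (j, i) = f (i, j) \<longleftrightarrow> (f (j, i) = 1 \<longleftrightarrow> f (i, j) = 1)" if "(j, i) \<in> F" for j i
  proof -
    have "(i, j) \<in> F" using assms(1) that unfolding symmetric_shape_def by blast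
    then have "f (j, i) \<in> {0, 1}" "f (i, j) \<in> {0, 1}"
      using assms(2) that unfolding fillings_def by blast+
    then show ?thesis by auto
  qed
  moreover have "(ones F f)\<inverse> = ones F f \<longleftrightarrow> (\<forall>j i. (j, i) \<in> F \<longrightarrow> (f (j, i) = 1 \<longleftrightarrow> f (i, j) = 1))"
    using assms(1) unfolding symmetric_shape_def ones_def by auto
  ultimately show ?thesis
    unfolding symmetric_filling_def by blast
qed

text \<open>The relation "conjugate boundary labels" is total and injective from one set to the
  other, which gives an inequality; exchanging \<open>s\<close> and \<open>t\<close> gives its
  converse.\<close>

lemma card_sym_fillings_le:
  assumes "ferrers_shape F" "symmetric_shape F"
  shows "card (sym_fillings F n s t) \<le> card (sym_fillings F n t s)"
proof (rule card_le_if_inj_on_rel)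
  let ?r = "\<lambda>f g. \<forall>a b. boundary F a b \<longrightarrow> shape (ones F g) a b = conjugate (shape (ones F f) a b)"
  note F = ferrers_shape_down_closed[OF assms(1)]
  have sym: "F\<inverse> = F"
    using assms(2) unfolding symmetric_shape_def by auto
  have perm: "partial_perm (ones F f)" if "f \<in> sym_fillings F n s t" for f s t
    using that partial_perm_ones_iff[OF F(2)] by (simp add: sym_fillings_def)
  have "finite (fillings F)"
    unfolding fillings_def using F(1) by (intro finite_PiE) auto
  then show "finite (sym_fillings F n t s)"
    by (simp add: sym_fillings_def)
  show "\<exists>g. g \<in> sym_fillings F n t s \<and> ?r f g" if f: "f \<in> sym_fillings F n s t" for f
  proof -
    let ?P = "ones F f"
    have P: "partial_perm ?P" "?P \<subseteq> F" "?P\<inverse> = ?P"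
      using perm[OF f] f symmetric_filling_iff_ones[OF assms(2), of f]
      by (auto simp: sym_fillings_def ones_def)
    obtain Q where Q: "Q \<subseteq> F" "partial_perm Q" "Q\<inverse> = Q"
      and shape: "\<And>a b. boundary F a b \<Longrightarrow> shape Q a b = conjugate (shape ?P a b)"
      using conjugate_filling_exists[OF F sym P] by blast
    define g where "g = (\<lambda>c\<in>F. if c \<in> Q then 1 else (0::nat))"
    have ones: "ones F g = Q"
      using Q(1) by (auto simp: ones_def g_def)
    have g: "g \<in> fillings F"
      unfolding fillings_def g_def by auto
    have g_perm: "partial_perm (ones F g)"
      using Q ones by simp
    have conj_Q: "conjugate (shape Q a b) = shape ?P a b" if "boundary F a b" for a b
      using shape[OF that] conjugate_conjugate[OF partition_shape[OF P(1)]] by simp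
    \<comment> \<open>The two sets of attained lengths coincide, hence so do their maxima.\<close>
    have "longest_NE F g = longest_SE F f"
      unfolding longest_NE_def longest_SE_def lengths_NE_chain[OF F(1) g_perm]
        lengths_SE_chain[OF F P(1)] ones
      using shape by (metis (no_types, lifting))
    moreover have "longest_SE F g = longest_NE F f"
      unfolding longest_NE_def longest_SE_def lengths_NE_chain[OF F(1) P(1)]
        lengths_SE_chain[OF F g_perm] ones
      using conj_Q by (metis (no_types, lifting))
    moreover have "card Q = card ?P"
      using card_eq_of_conjugate_shapes[OF F P(1,2) Q(2,1) shape] .
    ultimately have "g \<in> sym_fillings F n t s"
      using f g g_perm ones Q(3) partial_perm_ones_iff[OF F(2), of g]
        symmetric_filling_iff_ones[OF assms(2) g]
      by (simp add: sym_fillings_def)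
    then show ?thesis
      using shape ones by blast
  qed
  show "f = f'" if "f \<in> sym_fillings F n s t" "f' \<in> sym_fillings F n s t"
    and r: "?r f g" "?r f' g" for f f' g
  proof -
    have "shape (ones F f) a b = shape (ones F f') a b" if "boundary F a b" for a b
      using r that conjugate_conjugate[OF partition_shape[OF perm]] \<open>f \<in> _\<close> \<open>f' \<in> _\<close> by metis
    then have "ones F f = ones F f'"
      using shape_boundary_inj[OF F perm perm] that(1,2) by (auto simp: ones_def)
    then show ?thesis
      using fillings_eq_iff_ones that(1,2) by (auto simp: sym_fillings_def)
  qed
qed

theorem theorem14:
  fixes F :: "cell set" and n s t :: nat
  assumes "ferrers_shape F" and "symmetric_shape F" and "s \<ge> 1" and "t \<ge> 1"
  shows "N_sym F n s t = N_sym F n t s"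
  using card_sym_fillings_le[OF assms(1,2)]
  unfolding N_sym_def sym_fillings_def[symmetric] by (intro antisym)

end
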